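(* There exist a metric space $(Z,\rho)$ and a map $H:Z\to Z$ such that: (i) $Z$ is compact with respect to $\rho$ and $H$ is a homeomorphism. (ii) For some $\varepsilon>0$ we have $$\liminf_{T\to\infty}\frac{\ln \mathrm{span}(Z,\varepsilon,\rho_T)}{T}<\limsup_{T\to\infty}\frac{\ln \mathrm{span}(Z,\varepsilon,\rho_T)}{T}.$$ (iii) For all $\delta>0$ we have $$\liminf_{T\to\infty}\frac{\ln \mathrm{sep}(Z,\delta,\rho_T)}{T}=\limsup_{T\to\infty}\frac{\ln \mathrm{sep}(Z,\delta,\rho_T)}{T}.$$ (iv) $h(Z,H)<\infty$.
   Context: For a metric space $(Z,\rho)$, a continuous map $H:Z\to Z$ and an integer $T\ge 1$, $\rho_T(x,y)=\max\{\rho(H^t(x),H^t(y)):0\le t\le T-1\}$. Limits as $T\to\infty$ are over positive integers. For a metric $\mu$ on $Z$ and $\varepsilon>0$: a set of points is $\varepsilon$-separated if any two distinct points in it have $\mu$-distance $\ge\varepsilon$, and $\mathrm{sep}(Z,\varepsilon,\mu)$ is the maximum size of an $\varepsilon$-separated subset of $Z$; a set $S\subset Z$ is $\varepsilon$-spanning if for all $z\in Z$ there is $s\in S$ with $\mu(s,z)<\varepsilon$, and $\mathrm{span}(Z,\varepsilon,\mu)$ is the minimum size of an $\varepsilon$-spanning subset of $Z$. The topological entropy is $h(Z,H)=\lim_{\varepsilon\to0^+}\limsup_{T\to\infty}\frac{\ln \mathrm{span}(Z,\varepsilon,\rho_T)}{T}\in[0,\infty]$ (the same value is obtained with sep). 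*)

theory Defs
  imports "HOL-Analysis.Analysis"
begin

text \<open>
  A metric space is a carrier set \<open>Z\<close> with a metric \<open>\<rho>\<close> on it, as in \<open>Metric_space Z \<rho>\<close>. Taking
  \<open>Z\<close> inside the type \<open>int \<Rightarrow> real\<close> is no restriction on compact spaces: a compact metric space has
  at most the cardinality of the continuum, and \<open>\<rho>\<close> need not be related to the product topology.
\<close>

text \<open>Only used for \<open>T \<ge> 1\<close>: for \<open>T = 0\<close> the maximum is over the empty set and hence unspecified.\<close>

definition bowen_dist :: "('a \<Rightarrow> 'a \<Rightarrow> real) \<Rightarrow> ('a \<Rightarrow> 'a) \<Rightarrow> nat \<Rightarrow> 'a \<Rightarrow> 'a \<Rightarrow> real" where
  "bowen_dist \<rho> H T x y = Max ((\<lambda>t. \<rho> ((H ^^ t) x) ((H ^^ t) y)) ` {..<T})"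

definition separated_set :: "real \<Rightarrow> ('a \<Rightarrow> 'a \<Rightarrow> real) \<Rightarrow> 'a set \<Rightarrow> bool" where
  "separated_set \<epsilon> \<mu> S \<longleftrightarrow> (\<forall>x\<in>S. \<forall>y\<in>S. x \<noteq> y \<longrightarrow> \<mu> x y \<ge> \<epsilon>)"

definition spanning_set :: "'a set \<Rightarrow> real \<Rightarrow> ('a \<Rightarrow> 'a \<Rightarrow> real) \<Rightarrow> 'a set \<Rightarrow> bool" where
  "spanning_set Z \<epsilon> \<mu> S \<longleftrightarrow> S \<subseteq> Z \<and> (\<forall>z\<in>Z. \<exists>s\<in>S. \<mu> s z < \<epsilon>)"

text \<open>
  The maximum and the minimum below exist when \<open>\<mu>\<close> is a totally bounded metric on \<open>Z\<close>
  and \<open>\<epsilon> > 0\<close>; in particular they exist for all Bowen metrics of a continuous self-map of a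
  compact metric space. Finiteness is required because \<open>card\<close> is \<open>0\<close> on infinite sets; it
  excludes nothing in the totally bounded case.
\<close>

definition sep_number :: "'a set \<Rightarrow> real \<Rightarrow> ('a \<Rightarrow> 'a \<Rightarrow> real) \<Rightarrow> nat" where
  "sep_number Z \<epsilon> \<mu> = (GREATEST n. \<exists>S\<subseteq>Z. finite S \<and> separated_set \<epsilon> \<mu> S \<and> card S = n)"

definition span_number :: "'a set \<Rightarrow> real \<Rightarrow> ('a \<Rightarrow> 'a \<Rightarrow> real) \<Rightarrow> nat" where
  "span_number Z \<epsilon> \<mu> = (LEAST n. \<exists>S. finite S \<and> spanning_set Z \<epsilon> \<mu> S \<and> card S = n)"

definition sep_rate :: "'a set \<Rightarrow> ('a \<Rightarrow> 'a \<Rightarrow> real) \<Rightarrow> ('a \<Rightarrow> 'a) \<Rightarrow> real \<Rightarrow> nat \<Rightarrow> ereal" where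
  "sep_rate Z \<rho> H \<epsilon> T = ereal (ln (real (sep_number Z \<epsilon> (bowen_dist \<rho> H T))) / real T)"

definition span_rate :: "'a set \<Rightarrow> ('a \<Rightarrow> 'a \<Rightarrow> real) \<Rightarrow> ('a \<Rightarrow> 'a) \<Rightarrow> real \<Rightarrow> nat \<Rightarrow> ereal" where
  "span_rate Z \<rho> H \<epsilon> T = ereal (ln (real (span_number Z \<epsilon> (bowen_dist \<rho> H T))) / real T)"

definition topological_entropy :: "'a set \<Rightarrow> ('a \<Rightarrow> 'a \<Rightarrow> real) \<Rightarrow> ('a \<Rightarrow> 'a) \<Rightarrow> ereal" where
  "topological_entropy Z \<rho> H = Lim (at_right 0) (\<lambda>\<epsilon>. limsup (span_rate Z \<rho> H \<epsilon>))"

end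

theory Submission
  imports Defs "HOL-Real_Asymp.Real_Asymp"
begin

text \<open>
  Spanning and separated sets count different features of the graph that joins two points whose
  Bowen distance is below \<open>\<epsilon>\<close>: the least size of a dominating set and the largest size of an
  independent set. In a star the first is \<open>1\<close> and the second is the number of leaves. The example
  is a subshift in which, at one scale, the centres of the stars exist for some lengths \<open>T\<close>
  much more than for others, while the leaves are equally plentiful at all lengths.

  The letters are \<open>-1\<close>, \<open>0\<close>, \<open>1\<close> and a marker \<open>3\<close>, at mutual distance \<open>\<bar>a - b\<bar>\<close> capped at \<open>2\<close>. Thus
  \<open>0\<close> is at distance \<open>1\<close> from \<open>-1\<close> and \<open>1\<close>, and all other pairs of distinct letters are at distance
  \<open>2\<close>. The metric on sequences weights position \<open>n\<close> by \<open>1 / 2 ^ nat \<bar>n\<bar>\<close>, so that at scale \<open>2\<close> the Bowen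
  metric compares exactly the letters at the positions \<open>0, \<dots>, T - 1\<close>, and there the zero word
  dominates every word without marker. A point carries at most one marker, and if it has one at
  \<open>m\<close>, then it must have a sign \<open>-1\<close> or \<open>1\<close> at every position \<open>m + k\<close> with \<open>k \<in> runs\<close>. If
  \<open>0 \<le> m < T\<close>, then a point close to such a point has a marker at \<open>m\<close> too, so it has to guess
  those of the signs that lie in the window. With
  \<open>g T = card (runs \<inter> {..<T})\<close> this gives spanning numbers between \<open>2 ^ g T\<close> and
  \<open>1 + T * 2 ^ g T\<close> (\<open>span_number_coarse\<close>). As \<open>runs\<close> is a union of long, sparsely placed blocks,
  \<open>g T / T\<close> oscillates (\<open>runs_dense\<close>, \<open>runs_sparse\<close>).

  The marker is there because of Fekete's lemma. If the number of signs that have to be guessed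
  were the least or the greatest number of forced signs in a window of length \<open>T\<close> of some
  shift-invariant family of patterns, it would be super- or subadditive in \<open>T\<close>, and its quotient
  by \<open>T\<close> would converge. A marker in the window fixes the position of the pattern, so that what counts
  is how many elements of \<open>runs\<close> lie in an initial segment; once it has left the window, the zero
  word dominates again.

  The separated sets see nothing of this. At scales in \<open>{1<..2}\<close> the marker-free words
  over \<open>{-1, 1}\<close> are separated, and \<open>(T + 1) * 2 ^ T\<close> classes of mutually close points cover
  everything, since one marker costs only a linear factor. At scales up to \<open>1\<close> the same happens with
  all three unmarked letters, and above \<open>2\<close> everything is close. So the rate of \<open>sep\<close> converges to
  \<open>ln 2\<close>, \<open>ln 3\<close> and \<open>0\<close>, respectively (\<open>sep_rate_convergent\<close>). The small scales also show that
  the entropy is \<open>ln 3\<close>.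
\<close>

section \<open>Counting with codes and with families\<close>

lemma span_number_le_card:
  assumes "finite S" "spanning_set Z \<epsilon> \<mu> S"
  shows "span_number Z \<epsilon> \<mu> \<le> card S"
  unfolding span_number_def using assms by (intro Least_le) blast

text \<open>
  No member of a spanning set can serve two points of \<open>P\<close>.
\<close>

lemma span_number_ge_card:
  assumes S: "finite S" "spanning_set Z \<epsilon> \<mu> S"
    and P: "P \<subseteq> Z"
    and uniq: "\<And>z p q. z \<in> Z \<Longrightarrow> p \<in> P \<Longrightarrow> q \<in> P \<Longrightarrow> \<mu> z p < \<epsilon> \<Longrightarrow> \<mu> z q < \<epsilon> \<Longrightarrow> p = q"
  shows "card P \<le> span_number Z \<epsilon> \<mu>"
proof -
  have "\<exists>S. finite S \<and> spanning_set Z \<epsilon> \<mu> S \<and> card S = span_number Z \<epsilon> \<mu>"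
    unfolding span_number_def by (rule LeastI_ex) (use S in blast)
  then obtain R where R: "finite R" "spanning_set Z \<epsilon> \<mu> R" "card R = span_number Z \<epsilon> \<mu>"
    by blast
  have "\<forall>p\<in>P. \<exists>s\<in>R. \<mu> s p < \<epsilon>"
    using R(2) P unfolding spanning_set_def by blast
  then obtain f where f: "\<And>p. p \<in> P \<Longrightarrow> f p \<in> R \<and> \<mu> (f p) p < \<epsilon>"
    by metis
  have "R \<subseteq> Z" using R(2) unfolding spanning_set_def by blast
  then have "inj_on f P"
    by (intro inj_onI) (metis f uniq subsetD)
  then show ?thesis
    using card_inj_on_le[of f P R] f R by auto
qed

text \<open>
  A map \<open>f\<close> whose fibres consist of mutually close points bounds both numbers: one representative
  per fibre spans, and, in the next lemma, a separated set has at most one point in each fibre.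
\<close>

lemma spanning_set_of_codes:
  assumes fin: "finite (f ` Z)"
    and close: "\<And>x y. x \<in> Z \<Longrightarrow> y \<in> Z \<Longrightarrow> f x = f y \<Longrightarrow> \<mu> x y < \<epsilon>"
  obtains S where "finite S" "spanning_set Z \<epsilon> \<mu> S" "card S \<le> card (f ` Z)"
proof
  let ?S = "inv_into Z f ` f ` Z"
  show "finite ?S" using fin by blast
  show "card ?S \<le> card (f ` Z)" using fin by (rule card_image_le)
  show "spanning_set Z \<epsilon> \<mu> ?S"
    unfolding spanning_set_def
  proof (intro conjI ballI)
    show "?S \<subseteq> Z" by (auto intro: inv_into_into)
    fix z assume z: "z \<in> Z"
    have "\<mu> (inv_into Z f (f z)) z < \<epsilon>"
      by (rule close) (use z in \<open>auto intro: inv_into_into f_inv_into_f\<close>)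
    then show "\<exists>s\<in>?S. \<mu> s z < \<epsilon>" using z by blast
  qed
qed

lemma sep_number_bounds:
  assumes fin: "finite (f ` Z)"
    and close: "\<And>x y. x \<in> Z \<Longrightarrow> y \<in> Z \<Longrightarrow> f x = f y \<Longrightarrow> \<mu> x y < \<epsilon>"
    and P: "P \<subseteq> Z" "finite P" "separated_set \<epsilon> \<mu> P"
  shows "card P \<le> sep_number Z \<epsilon> \<mu>" "sep_number Z \<epsilon> \<mu> \<le> card (f ` Z)"
proof -
  define Q where "Q n \<longleftrightarrow> (\<exists>S\<subseteq>Z. finite S \<and> separated_set \<epsilon> \<mu> S \<and> card S = n)" for n
  have bound: "n \<le> card (f ` Z)" if n: "Q n" for n
  proof -
    obtain S where S: "S \<subseteq> Z" "separated_set \<epsilon> \<mu> S" "card S = n"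
      using n unfolding Q_def by blast
    have "inj_on f S"
    proof (rule inj_onI, rule ccontr)
      fix x y assume xy: "x \<in> S" "y \<in> S" "f x = f y" "x \<noteq> y"
      then have "\<epsilon> \<le> \<mu> x y" using S(2) by (simp add: separated_set_def)
      moreover have "\<mu> x y < \<epsilon>" using xy S(1) by (intro close) auto
      ultimately show False by simp
    qed
    then show ?thesis
      using card_inj_on_le[of f S "f ` Z"] S fin by blast
  qed
  have QP: "Q (card P)" unfolding Q_def using P by blast
  have eq: "sep_number Z \<epsilon> \<mu> = (GREATEST n. Q n)" unfolding sep_number_def Q_def by simp
  show "card P \<le> sep_number Z \<epsilon> \<mu>"
    unfolding eq by (rule Greatest_le_nat[where P = Q, OF QP bound])
  have "Q (GREATEST n. Q n)"
    by (rule GreatestI_nat[where P = Q, OF QP bound])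
  then show "sep_number Z \<epsilon> \<mu> \<le> card (f ` Z)"
    unfolding eq by (rule bound)
qed

text \<open>
  The upper bound allows for enlarging a window of length \<open>T\<close> by \<open>K\<close> on either side and for the
  choice of a marker position; neither affects the exponential rate.
\<close>

lemma exponential_growth_rate:
  fixes N :: "nat \<Rightarrow> nat" and \<alpha> K :: nat
  assumes "\<alpha> \<ge> 1"
    and lo: "\<And>T. T \<ge> 1 \<Longrightarrow> \<alpha> ^ T \<le> N T"
    and up: "\<And>T. T \<ge> 1 \<Longrightarrow> N T \<le> (T + 2 * K + 1) * \<alpha> ^ (T + 2 * K)"
  shows "(\<lambda>T. ereal (ln (real (N T)) / real T)) \<longlonglongrightarrow> ereal (ln (real \<alpha>))"
proof -
  define u where "u T = ln (real T + (2 * real K + 1)) / real T + 2 * real K * ln \<alpha> / real T + ln \<alpha>"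
    for T :: nat
  have "(\<lambda>T::nat. ln (real T + (2 * real K + 1)) / real T) \<longlonglongrightarrow> 0"
    by real_asymp
  moreover have "(\<lambda>T::nat. 2 * real K * ln \<alpha> / real T) \<longlonglongrightarrow> 0"
    by (rule lim_const_over_n)
  ultimately have "u \<longlonglongrightarrow> 0 + 0 + ln \<alpha>"
    unfolding u_def by (intro tendsto_intros)
  then have u: "u \<longlonglongrightarrow> ln \<alpha>" by simp
  have bounds: "ln \<alpha> \<le> ln (N T) / T \<and> ln (N T) / T \<le> u T" if T: "T \<ge> 1" for T
  proof -
    have "real \<alpha> ^ T \<le> real (N T)"
      using lo[OF T] by (metis of_nat_le_iff of_nat_power)
    moreover have pos: "0 < real \<alpha> ^ T" using assms(1) by simp
    ultimately have "ln (real \<alpha> ^ T) \<le> ln (N T)"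
      using ln_le_cancel_iff[of "real \<alpha> ^ T" "real (N T)"] by linarith
    then have 1: "T * ln \<alpha> \<le> ln (N T)"
      using assms(1) by (simp add: ln_realpow)
    have "real (N T) \<le> real ((T + 2 * K + 1) * \<alpha> ^ (T + 2 * K))"
      using up[OF T] of_nat_le_iff by blast
    moreover have "0 < real (N T)"
      using pos \<open>real \<alpha> ^ T \<le> real (N T)\<close> by linarith
    ultimately have "ln (N T) \<le> ln (real ((T + 2 * K + 1) * \<alpha> ^ (T + 2 * K)))"
      by simp
    also have "real ((T + 2 * K + 1) * \<alpha> ^ (T + 2 * K)) =
        (real T + (2 * real K + 1)) * real \<alpha> ^ (T + 2 * K)"
      by (simp add: algebra_simps)
    also have "ln \<dots> = ln (real T + (2 * real K + 1)) + ln (real \<alpha> ^ (T + 2 * K))"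
      using assms(1) by (intro ln_mult_pos) auto
    also have "ln (real \<alpha> ^ (T + 2 * K)) = (T + 2 * K) * ln \<alpha>"
      using assms(1) by (intro ln_realpow)
    finally have 2: "ln (N T) \<le> ln (real T + (2 * real K + 1)) + (T + 2 * K) * ln \<alpha>" .
    show ?thesis
      using 1 2 T unfolding u_def by (simp add: field_simps)
  qed
  have "(\<lambda>T. ln (real (N T)) / real T) \<longlonglongrightarrow> ln \<alpha>"
    by (rule tendsto_sandwich[OF _ _ tendsto_const u])
       (use bounds in \<open>auto intro: eventually_sequentiallyI[of 1]\<close>)
  then show ?thesis by simp
qed

section \<open>The sequence metric\<close>

text \<open>
  The cap puts the letter \<open>3\<close> at the same distance from each of \<open>-1\<close>, \<open>0\<close> and \<open>1\<close>.
\<close>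

definition letter_dist :: "real \<Rightarrow> real \<Rightarrow> real" where
  "letter_dist a b = min 2 \<bar>a - b\<bar>"

definition seq_dist :: "(int \<Rightarrow> real) \<Rightarrow> (int \<Rightarrow> real) \<Rightarrow> real" where
  "seq_dist x y = (SUP n. letter_dist (x n) (y n) / 2 ^ nat \<bar>n\<bar>)"

lemma letter_dist_bounds: "0 \<le> letter_dist a b" "letter_dist a b \<le> 2"
  unfolding letter_dist_def by auto

lemma term_le_seq_dist: "letter_dist (x n) (y n) / 2 ^ nat \<bar>n\<bar> \<le> seq_dist x y"
  unfolding seq_dist_def
proof (rule cSUP_upper)
  show "bdd_above (range (\<lambda>n. letter_dist (x n) (y n) / 2 ^ nat \<bar>n\<bar>))"
  proof (rule bdd_aboveI2)
    fix n
    have "letter_dist (x n) (y n) \<le> 2 * 1" using letter_dist_bounds by simp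
    also have "\<dots> \<le> 2 * 2 ^ nat \<bar>n\<bar>" by (intro mult_left_mono) auto
    finally show "letter_dist (x n) (y n) / 2 ^ nat \<bar>n\<bar> \<le> 2" by (simp add: field_simps)
  qed
qed simp

lemma seq_dist_leI:
  assumes "\<And>n. letter_dist (x n) (y n) / 2 ^ nat \<bar>n\<bar> \<le> c"
  shows "seq_dist x y \<le> c"
  unfolding seq_dist_def by (rule cSUP_least) (use assms in auto)

text \<open>
  Outside \<open>{-K..K}\<close> the weights are at most \<open>1 / 2 ^ (K + 1)\<close> and letters are at most \<open>2\<close> apart.
\<close>

lemma seq_dist_le_of_window:
  assumes win: "\<And>n. \<bar>n\<bar> \<le> int K \<Longrightarrow> letter_dist (x n) (y n) \<le> c"
    and c: "1 / 2 ^ K \<le> c"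
  shows "seq_dist x y \<le> c"
proof (rule seq_dist_leI)
  fix n :: int
  show "letter_dist (x n) (y n) / 2 ^ nat \<bar>n\<bar> \<le> c"
  proof (cases "\<bar>n\<bar> \<le> int K")
    case True
    have "letter_dist (x n) (y n) / 2 ^ nat \<bar>n\<bar> \<le> letter_dist (x n) (y n) / 1"
      by (intro divide_left_mono) (auto simp: letter_dist_bounds)
    then show ?thesis using win[OF True] by simp
  next
    case False
    then have "Suc K \<le> nat \<bar>n\<bar>" by linarith
    then have "(2::real) ^ Suc K \<le> 2 ^ nat \<bar>n\<bar>" by (intro power_increasing) auto
    then have "letter_dist (x n) (y n) / 2 ^ nat \<bar>n\<bar> \<le> 2 / 2 ^ Suc K"
      by (intro frac_le) (auto simp: letter_dist_bounds)
    also have "\<dots> \<le> c" using c by simp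
    finally show ?thesis .
  qed
qed

lemma seq_dist_metric: "Metric_space Z seq_dist"
proof
  fix x y z
  show nn: "0 \<le> seq_dist x y" for x y
    using term_le_seq_dist[of x 0 y] letter_dist_bounds(1)[of "x 0" "y 0"] by simp
  show "seq_dist x y = seq_dist y x"
    unfolding seq_dist_def letter_dist_def by (simp add: abs_minus_commute)
  show "seq_dist x y = 0 \<longleftrightarrow> x = y"
  proof
    assume *: "seq_dist x y = 0"
    show "x = y"
    proof
      fix n
      have "letter_dist (x n) (y n) \<le> 0"
        using term_le_seq_dist[of x n y] * by (simp add: pos_divide_le_eq)
      then show "x n = y n" by (auto simp: letter_dist_def min_def split: if_splits)
    qed
  next
    assume "x = y"
    then show "seq_dist x y = 0" by (simp add: seq_dist_def letter_dist_def)
  qed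
  show "seq_dist x z \<le> seq_dist x y + seq_dist y z"
  proof (rule seq_dist_leI)
    fix n :: int
    have "letter_dist (x n) (z n) \<le> letter_dist (x n) (y n) + letter_dist (y n) (z n)"
      unfolding letter_dist_def by linarith
    then have "letter_dist (x n) (z n) / 2 ^ nat \<bar>n\<bar> \<le>
        letter_dist (x n) (y n) / 2 ^ nat \<bar>n\<bar> + letter_dist (y n) (z n) / 2 ^ nat \<bar>n\<bar>"
      by (simp add: divide_right_mono flip: add_divide_distrib)
    then show "letter_dist (x n) (z n) / 2 ^ nat \<bar>n\<bar> \<le> seq_dist x y + seq_dist y z"
      using term_le_seq_dist[of x n y] term_le_seq_dist[of y n z] by linarith
  qed
qed

definition shift :: "(int \<Rightarrow> real) \<Rightarrow> int \<Rightarrow> real" where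
  "shift x = (\<lambda>n. x (n + 1))"

lemma shift_iterate: "(shift ^^ t) x = (\<lambda>n. x (n + int t))"
  by (induction t) (auto simp: shift_def algebra_simps)

lemma letter_le_bowen_dist:
  assumes "0 \<le> n" "n < int T"
  shows "letter_dist (x n) (y n) \<le> bowen_dist seq_dist shift T x y"
proof -
  have "letter_dist (x n) (y n) \<le> seq_dist ((shift ^^ nat n) x) ((shift ^^ nat n) y)"
    using term_le_seq_dist[of "(shift ^^ nat n) x" 0 "(shift ^^ nat n) y"] assms
    by (simp add: shift_iterate)
  also have "\<dots> \<le> bowen_dist seq_dist shift T x y"
    unfolding bowen_dist_def by (rule Max_ge) (use assms in auto)
  finally show ?thesis .
qed

lemma bowen_dist_le_of_window:
  assumes "T \<ge> 1"
    and win: "\<And>n. n \<in> {- int K..<int T + int K} \<Longrightarrow> letter_dist (x n) (y n) \<le> c"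
    and c: "1 / 2 ^ K \<le> c"
  shows "bowen_dist seq_dist shift T x y \<le> c"
proof -
  have "seq_dist ((shift ^^ t) x) ((shift ^^ t) y) \<le> c" if "t < T" for t
  proof (rule seq_dist_le_of_window[OF _ c])
    fix n :: int assume "\<bar>n\<bar> \<le> int K"
    then have "n + int t \<in> {- int K..<int T + int K}" using that by auto
    then show "letter_dist ((shift ^^ t) x n) ((shift ^^ t) y n) \<le> c"
      unfolding shift_iterate by (rule win)
  qed
  then show ?thesis
    unfolding bowen_dist_def using assms(1) by (subst Max_le_iff) (auto simp: lessThan_empty_iff)
qed

section \<open>The marked shift\<close>

text \<open>
  The run starting at \<open>16 ^ k\<close> makes up three quarters of \<open>{..<4 * 16 ^ k}\<close>, but all runs
  together make up at most a quarter of \<open>{..<16 ^ (k + 1)}\<close>.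
\<close>

definition runs :: "nat set" where
  "runs = {n. \<exists>k. 16 ^ k \<le> n \<and> n < 4 * 16 ^ k}"

definition letters :: "real set" where
  "letters = {-1, 0, 1, 3}"

definition marked_shift :: "(int \<Rightarrow> real) set" where
  "marked_shift = {x. (\<forall>n. x n \<in> letters) \<and> (\<forall>m n. x m = 3 \<and> x n = 3 \<longrightarrow> m = n) \<and>
     (\<forall>m. \<forall>n\<in>runs. x m = 3 \<longrightarrow> x (m + int n) \<in> {-1, 1})}"

lemma marked_shiftD:
  assumes "x \<in> marked_shift"
  shows "x n \<in> letters" "x m = 3 \<Longrightarrow> x n = 3 \<Longrightarrow> m = n"
    "k \<in> runs \<Longrightarrow> x m = 3 \<Longrightarrow> x (m + int k) \<in> {-1, 1}"
  using assms unfolding marked_shift_def by blast+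

lemma marked_shiftI:
  assumes "\<And>n. x n \<in> letters"
    and "\<And>m n. x m = 3 \<Longrightarrow> x n = 3 \<Longrightarrow> m = n"
    and "\<And>m k. k \<in> runs \<Longrightarrow> x m = 3 \<Longrightarrow> x (m + int k) \<in> {-1, 1}"
  shows "x \<in> marked_shift"
  using assms by (simp add: marked_shift_def)

lemma runs_pos: "n \<in> runs \<Longrightarrow> 0 < n"
  unfolding runs_def using less_le_trans[OF zero_less_power[of "16::nat"]] by auto

lemma translate_marked_shift:
  assumes "x \<in> marked_shift"
  shows "(\<lambda>n. x (n + k)) \<in> marked_shift"
proof (rule marked_shiftI)
  show "x (n + k) \<in> letters" for n by (rule marked_shiftD(1)[OF assms])
  show "m = n" if "x (m + k) = 3" "x (n + k) = 3" for m n
    using marked_shiftD(2)[OF assms that] by simp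
  show "x (m + int n + k) \<in> {-1, 1}" if "n \<in> runs" "x (m + k) = 3" for m n
    using marked_shiftD(3)[OF assms that] by (simp add: algebra_simps)
qed

lemma seq_dist_translate_le:
  "seq_dist (\<lambda>n. x (n + k)) (\<lambda>n. y (n + k)) \<le> 2 ^ nat \<bar>k\<bar> * seq_dist x y"
proof (rule seq_dist_leI)
  fix n :: int
  have "nat \<bar>n + k\<bar> \<le> nat \<bar>k\<bar> + nat \<bar>n\<bar>" by linarith
  then have "(2::real) ^ nat \<bar>n + k\<bar> \<le> 2 ^ (nat \<bar>k\<bar> + nat \<bar>n\<bar>)"
    by (rule power_increasing) simp
  then have le: "(2::real) ^ nat \<bar>n + k\<bar> \<le> 2 ^ nat \<bar>k\<bar> * 2 ^ nat \<bar>n\<bar>"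
    by (simp add: power_add)
  have "letter_dist (x (n + k)) (y (n + k)) / 2 ^ nat \<bar>n\<bar> =
      2 ^ nat \<bar>k\<bar> * (letter_dist (x (n + k)) (y (n + k)) / (2 ^ nat \<bar>k\<bar> * 2 ^ nat \<bar>n\<bar>))"
    by simp
  also have "\<dots> \<le> 2 ^ nat \<bar>k\<bar> * (letter_dist (x (n + k)) (y (n + k)) / 2 ^ nat \<bar>n + k\<bar>)"
    by (intro mult_left_mono divide_left_mono le) (auto simp: letter_dist_bounds)
  also have "\<dots> \<le> 2 ^ nat \<bar>k\<bar> * seq_dist x y"
    by (intro mult_left_mono term_le_seq_dist) auto
  finally show "letter_dist (x (n + k)) (y (n + k)) / 2 ^ nat \<bar>n\<bar> \<le> 2 ^ nat \<bar>k\<bar> * seq_dist x y" .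
qed

lemma continuous_translate:
  "continuous_map (Metric_space.mtopology marked_shift seq_dist)
     (Metric_space.mtopology marked_shift seq_dist) (\<lambda>x n. x (n + k))"
proof -
  interpret Metric_space marked_shift seq_dist by (rule seq_dist_metric)
  have "\<exists>U. openin mtopology U \<and> x \<in> U \<and> (\<forall>y\<in>U. (\<lambda>n. y (n + k)) \<in> mball (\<lambda>n. x (n + k)) e)"
    if "x \<in> marked_shift" "e > 0" for x e
  proof (intro exI conjI ballI)
    let ?U = "mball x (e / 2 ^ nat \<bar>k\<bar>)"
    show "openin mtopology ?U" by simp
    show "x \<in> ?U" using that by simp
    fix y assume y: "y \<in> ?U"
    have "seq_dist (\<lambda>n. x (n + k)) (\<lambda>n. y (n + k)) \<le> 2 ^ nat \<bar>k\<bar> * seq_dist x y"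
      by (rule seq_dist_translate_le)
    also have "\<dots> < e" using y by (simp add: field_simps)
    finally show "(\<lambda>n. y (n + k)) \<in> mball (\<lambda>n. x (n + k)) e"
      using y that by (simp add: translate_marked_shift)
  qed
  then show ?thesis by (simp add: continuous_map_to_metric)
qed

lemma homeomorphic_shift:
  "homeomorphic_map (Metric_space.mtopology marked_shift seq_dist)
     (Metric_space.mtopology marked_shift seq_dist) shift"
proof -
  interpret Metric_space marked_shift seq_dist by (rule seq_dist_metric)
  have "homeomorphic_maps mtopology mtopology shift (\<lambda>x n. x (n - 1))"
    unfolding homeomorphic_maps_def
    using continuous_translate[of 1] continuous_translate[of "-1"] by (simp add: shift_def[abs_def])
  then show ?thesis by (rule homeomorphic_maps_imp_map)
qed

text \<open>
  The marked shift is closed in a product of finite sets, hence compact in the product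
  topology, and the metric topology is no finer than that.
\<close>

lemma compact_marked_shift: "compact_space (Metric_space.mtopology marked_shift seq_dist)"
proof -
  interpret Metric_space marked_shift seq_dist by (rule seq_dist_metric)
  have fin: "finite letters" by (simp add: letters_def)
  have "compactin (product_topology (\<lambda>_. euclideanreal) UNIV) (PiE UNIV (\<lambda>_::int. letters))"
    by (subst compactin_PiE) (auto intro!: finite_imp_compact fin)
  then have comp: "compact (PiE UNIV (\<lambda>_::int. letters))"
    by (simp add: euclidean_product_topology)
  have cont: "continuous_on UNIV (\<lambda>x. x n)" for n :: int
    by simp
  have open_letters: "open {x. x n \<in> A}" if "open A" for n :: int and A :: "real set"
    using open_vimage[OF that cont] by (simp add: vimage_def)
  have clo: "closed {x. x n \<in> A}" if "closed A" for n :: int and A :: "real set"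
    using closed_vimage[OF that cont] by (simp add: vimage_def)
  \<comment> \<open>\<open>x m \<noteq> 3\<close> is written as \<open>x m \<in> {-1,0,1}\<close>, so that each condition is visibly closed.\<close>
  have pre: "marked_shift = PiE UNIV (\<lambda>_. letters) \<inter>
      ((\<Inter>m. \<Inter>n\<in>-{m}. {x. x m \<in> {-1,0,1}} \<union> {x. x n \<in> {-1,0,1}}) \<inter>
      (\<Inter>m. \<Inter>k\<in>runs. {x. x m \<in> {-1,0,1}} \<union> {x. x (m + int k) \<in> {-1,1}}))" (is "_ = ?L \<inter> ?C")
  proof (rule set_eqI)
    fix x :: "int \<Rightarrow> real"
    have iff: "x m \<in> {-1,0,1} \<longleftrightarrow> x m \<noteq> 3" if "\<forall>n. x n \<in> letters" for m
      using that[rule_format, of m] by (auto simp: letters_def)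
    show "x \<in> marked_shift \<longleftrightarrow> x \<in> ?L \<inter> ?C"
    proof (cases "\<forall>n. x n \<in> letters")
      case True
      then show ?thesis
        unfolding marked_shift_def Int_iff INT_iff Un_iff mem_Collect_eq iff[OF True]
        by (auto simp: PiE_def Pi_def)
    next
      case False
      then show ?thesis by (auto simp: marked_shift_def PiE_def Pi_def)
    qed
  qed
  have "closed ?C"
    by (intro closed_Int closed_INT closed_Un ballI clo finite_imp_closed) auto
  then have compM: "compact marked_shift"
    unfolding pre by (rule compact_Int_closed[OF comp])
  have "continuous_map (top_of_set marked_shift) mtopology (\<lambda>x. x)"
    unfolding continuous_map_to_metric
  proof (intro ballI allI impI)
    fix x and e :: real assume x: "x \<in> topspace (top_of_set marked_shift)" and e: "0 < e"
    obtain K :: nat where K: "(1/2) ^ K < e"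
      using real_arch_pow_inv[OF e, of "1/2"] by auto
    let ?U = "marked_shift \<inter> (\<Inter>n\<in>{- int K..int K}. {y. y n \<in> ball (x n) (1 / 2 ^ K)})"
    show "\<exists>U. openin (top_of_set marked_shift) U \<and> x \<in> U \<and> (\<forall>y\<in>U. y \<in> mball x e)"
    proof (intro exI conjI ballI)
      show "openin (top_of_set marked_shift) ?U"
        by (intro openin_open_Int open_INT finite_atLeastAtMost_int ballI open_letters open_ball)
      show "x \<in> ?U" using x by simp
      fix y assume y: "y \<in> ?U"
      have "seq_dist x y \<le> 1 / 2 ^ K"
      proof (rule seq_dist_le_of_window[OF _ order_refl])
        fix n :: int assume "\<bar>n\<bar> \<le> int K"
        then have "n \<in> {- int K..int K}" by auto
        then have "y n \<in> ball (x n) (1 / 2 ^ K)" using y by blast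
        then show "letter_dist (x n) (y n) \<le> 1 / 2 ^ K"
          by (simp add: letter_dist_def dist_real_def min_le_iff_disj)
      qed
      also have "\<dots> < e" using K by (simp add: power_one_over)
      finally show "y \<in> mball x e" using x y by simp
    qed
  qed
  moreover have "compactin (top_of_set marked_shift) marked_shift"
    using compM by (simp add: compactin_subtopology)
  ultimately have "compactin mtopology ((\<lambda>x. x) ` marked_shift)"
    by (rule image_compactin[rotated])
  then show ?thesis by (simp add: compact_space_def)
qed

section \<open>Growth rates of separated sets\<close>

text \<open>
  The marker is recorded separately from the \<open>\<phi>\<close>-image of the letters: as there is at most
  one marker, it contributes a linear factor to the number of codes instead of raising
  the base of the exponential.
\<close>

definition window_code :: "int set \<Rightarrow> (real \<Rightarrow> real) \<Rightarrow> (int \<Rightarrow> real) \<Rightarrow> int set \<times> (int \<Rightarrow> real)" where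
  "window_code W \<phi> x = ({n \<in> W. x n = 3}, restrict (\<phi> \<circ> x) W)"

lemma card_window_codes:
  assumes W: "finite W" and A: "finite A" "\<phi> ` letters \<subseteq> A"
  shows "finite (window_code W \<phi> ` marked_shift)"
    "card (window_code W \<phi> ` marked_shift) \<le> (card W + 1) * card A ^ card W"
proof -
  let ?M = "insert {} ((\<lambda>n. {n}) ` W)"
  have sub: "window_code W \<phi> ` marked_shift \<subseteq> ?M \<times> (W \<rightarrow>\<^sub>E A)"
  proof
    fix c assume "c \<in> window_code W \<phi> ` marked_shift"
    then obtain x where x: "x \<in> marked_shift" "c = window_code W \<phi> x" by blast
    have "{n \<in> W. x n = 3} \<in> ?M"
    proof (cases "\<exists>m\<in>W. x m = 3")
      case True
      then obtain m where "m \<in> W" "x m = 3" by blast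
      then have "{n \<in> W. x n = 3} = {m}" using marked_shiftD(2)[OF x(1)] by blast
      then show ?thesis using \<open>m \<in> W\<close> by simp
    qed auto
    moreover have "restrict (\<phi> \<circ> x) W \<in> W \<rightarrow>\<^sub>E A"
      using A(2) marked_shiftD(1)[OF x(1)] by auto
    ultimately show "c \<in> ?M \<times> (W \<rightarrow>\<^sub>E A)" unfolding x(2) window_code_def by blast
  qed
  have fin: "finite (?M \<times> (W \<rightarrow>\<^sub>E A))"
    using W A(1) by (intro finite_cartesian_product finite_PiE) auto
  show "finite (window_code W \<phi> ` marked_shift)" by (rule finite_subset[OF sub fin])
  have "card (window_code W \<phi> ` marked_shift) \<le> card (?M \<times> (W \<rightarrow>\<^sub>E A))"
    by (rule card_mono[OF fin sub])
  also have "\<dots> = card ?M * card A ^ card W"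
    using W by (simp add: card_cartesian_product card_PiE)
  also have "card ?M \<le> card W + 1"
    using card_image_le[OF W, of "\<lambda>n. {n}"] W
    by (simp add: card_insert_if)
  finally show "card (window_code W \<phi> ` marked_shift) \<le> (card W + 1) * card A ^ card W"
    by simp
qed

definition padded_words :: "nat \<Rightarrow> real set \<Rightarrow> (int \<Rightarrow> real) set" where
  "padded_words T A = (\<lambda>w n. if n \<in> {0..<int T} then w n else 0) ` ({0..<int T} \<rightarrow>\<^sub>E A)"

lemma card_padded_words: "card (padded_words T A) = card A ^ T"
proof -
  have "inj_on (\<lambda>w n. if n \<in> {0..<int T} then w n else 0) ({0..<int T} \<rightarrow>\<^sub>E A)"
  proof (rule inj_onI)
    fix v w assume v: "v \<in> {0..<int T} \<rightarrow>\<^sub>E A" and w: "w \<in> {0..<int T} \<rightarrow>\<^sub>E A"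
      and eq: "(\<lambda>n. if n \<in> {0..<int T} then v n else 0) = (\<lambda>n. if n \<in> {0..<int T} then w n else (0::real))"
    show "v = w"
    proof (rule PiE_ext[OF v w])
      fix n assume "n \<in> {0..<int T}"
      then show "v n = w n" using fun_cong[OF eq, of n] by simp
    qed
  qed
  then show ?thesis unfolding padded_words_def by (simp add: card_image card_PiE)
qed

lemma padded_words_letter:
  "p \<in> padded_words T A \<Longrightarrow> n \<in> {0..<int T} \<Longrightarrow> p n \<in> A"
  by (auto simp: padded_words_def)

lemma padded_words_eqI:
  assumes "p \<in> padded_words T A" "q \<in> padded_words T A" "\<And>n. n \<in> {0..<int T} \<Longrightarrow> p n = q n"
  shows "p = q"
proof
  fix n show "p n = q n" using assms unfolding padded_words_def by (cases "n \<in> {0..<int T}") auto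
qed

lemma padded_words_marked_shift:
  assumes "A \<subseteq> {-1, 0, 1}"
  shows "padded_words T A \<subseteq> marked_shift"
proof
  fix p assume p: "p \<in> padded_words T A"
  have "p n \<in> {-1, 0, 1}" for n
  proof (cases "n \<in> {0..<int T}")
    case True
    then show ?thesis using padded_words_letter[OF p] assms by blast
  next
    case False
    then show ?thesis using p by (auto simp: padded_words_def)
  qed
  then have "p n \<in> letters \<and> p n \<noteq> 3" for n
    by (smt (verit, ccfv_threshold) insert_iff letters_def singletonD)
  then show "p \<in> marked_shift" by (intro marked_shiftI) auto
qed

lemma window_codes_determine:
  fixes T K :: nat
  defines "W \<equiv> {- int K..<int T + int K}"
  assumes A: "finite A" "\<phi> ` letters \<subseteq> A"
    and near: "\<And>a b. a \<in> letters \<Longrightarrow> b \<in> letters \<Longrightarrow> \<phi> a = \<phi> b \<Longrightarrow> a = 3 \<longleftrightarrow> b = 3 \<Longrightarrow>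
        letter_dist a b \<le> c"
    and c: "1 / 2 ^ K \<le> c" "c < \<delta>" and T: "T \<ge> 1"
  shows "finite (window_code W \<phi> ` marked_shift)"
    "card (window_code W \<phi> ` marked_shift) \<le> (T + 2 * K + 1) * card A ^ (T + 2 * K)"
    "\<And>x y. x \<in> marked_shift \<Longrightarrow> y \<in> marked_shift \<Longrightarrow> window_code W \<phi> x = window_code W \<phi> y \<Longrightarrow>
       bowen_dist seq_dist shift T x y < \<delta>"
proof -
  have W: "card W = T + 2 * K" by (simp add: W_def)
  have finW: "finite W" by (simp add: W_def)
  show "finite (window_code W \<phi> ` marked_shift)"
    by (rule card_window_codes(1)[OF finW A])
  show "card (window_code W \<phi> ` marked_shift) \<le> (T + 2 * K + 1) * card A ^ (T + 2 * K)"
    using card_window_codes(2)[OF finW A] W by simp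
  fix x y assume x: "x \<in> marked_shift" and y: "y \<in> marked_shift"
    and eq: "window_code W \<phi> x = window_code W \<phi> y"
  have "bowen_dist seq_dist shift T x y \<le> c"
  proof (rule bowen_dist_le_of_window[OF T _ c(1)])
    fix n assume "n \<in> {- int K..<int T + int K}"
    then have n: "n \<in> W" by (simp add: W_def)
    have "restrict (\<phi> \<circ> x) W n = restrict (\<phi> \<circ> y) W n"
      using eq unfolding window_code_def by simp
    moreover have "n \<in> {n \<in> W. x n = 3} \<longleftrightarrow> n \<in> {n \<in> W. y n = 3}"
      using eq unfolding window_code_def by simp
    ultimately show "letter_dist (x n) (y n) \<le> c"
      using n by (intro near marked_shiftD(1)[OF x] marked_shiftD(1)[OF y]) auto
  qed
  then show "bowen_dist seq_dist shift T x y < \<delta>" using c(2) by simp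
qed

text \<open>
  The alphabet \<open>A\<close> consists of letters at least \<open>\<delta>\<close> apart, so that words over it bound the
  separation number from below. The map \<open>\<phi>\<close> sorts all letters into \<open>card A\<close> classes of diameter
  at most \<open>c < \<delta>\<close>, up to the marker, so that codes bound it from above with the same base. The
  margin \<open>K\<close> has to be so large that positions further outside the window count for at most \<open>c\<close>.
\<close>

lemma sep_rate_tendsto:
  assumes A: "A \<subseteq> {-1, 0, 1}" "A \<noteq> {}" "\<phi> ` letters \<subseteq> A"
    and near: "\<And>a b. a \<in> letters \<Longrightarrow> b \<in> letters \<Longrightarrow> \<phi> a = \<phi> b \<Longrightarrow> a = 3 \<longleftrightarrow> b = 3 \<Longrightarrow>
        letter_dist a b \<le> c"
    and c: "1 / 2 ^ K \<le> c" "c < \<delta>"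
    and far: "\<And>a b. a \<in> A \<Longrightarrow> b \<in> A \<Longrightarrow> a \<noteq> b \<Longrightarrow> \<delta> \<le> letter_dist a b"
  shows "sep_rate marked_shift seq_dist shift \<delta> \<longlonglongrightarrow> ereal (ln (real (card A)))"
proof -
  have finA: "finite A" using A(1) finite_subset by blast
  have "card A ^ T \<le> sep_number marked_shift \<delta> (bowen_dist seq_dist shift T) \<and>
      sep_number marked_shift \<delta> (bowen_dist seq_dist shift T)
        \<le> (T + 2 * K + 1) * card A ^ (T + 2 * K)"
    if T: "T \<ge> 1" for T
  proof -
    note codes = window_codes_determine[OF finA A(3) near c T]
    have sep: "separated_set \<delta> (bowen_dist seq_dist shift T) (padded_words T A)"
      unfolding separated_set_def
    proof (intro ballI impI)
      fix p q assume p: "p \<in> padded_words T A" and q: "q \<in> padded_words T A" and "p \<noteq> q"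
      then obtain n where n: "n \<in> {0..<int T}" "p n \<noteq> q n" using padded_words_eqI by blast
      then have "\<delta> \<le> letter_dist (p n) (q n)"
        using padded_words_letter p q by (intro far) auto
      also have "\<dots> \<le> bowen_dist seq_dist shift T p q"
        using n by (intro letter_le_bowen_dist) auto
      finally show "\<delta> \<le> bowen_dist seq_dist shift T p q" .
    qed
    have "finite (padded_words T A)"
      unfolding padded_words_def using finA by (intro finite_imageI finite_PiE) auto
    note bounds = sep_number_bounds[OF codes(1,3) padded_words_marked_shift[OF A(1)] this sep]
    show ?thesis
      using bounds(1)[unfolded card_padded_words] order_trans[OF bounds(2) codes(2)] by blast
  qed
  then show ?thesis
    unfolding sep_rate_def[abs_def]
    using exponential_growth_rate[of "card A"
        "\<lambda>T. sep_number marked_shift \<delta> (bowen_dist seq_dist shift T)" K] A(2) finA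
    by (simp add: Suc_le_eq card_gt_0_iff)
qed

lemma fine_scale:
  fixes \<delta> :: real
  assumes "\<delta> > 0"
  obtains K :: nat where "1 / 2 ^ K < \<delta>"
  using real_arch_pow_inv[OF assms, of "1/2"] by (auto simp: power_one_over)

abbreviation erase_marker :: "real \<Rightarrow> real" where
  "erase_marker a \<equiv> if a = 3 then 0 else a"

lemma erase_marker_near:
  "a \<in> letters \<Longrightarrow> b \<in> letters \<Longrightarrow> erase_marker a = erase_marker b \<Longrightarrow> a = 3 \<longleftrightarrow> b = 3 \<Longrightarrow>
    letter_dist a b \<le> 1 / 2 ^ K"
  by (auto simp: letter_dist_def split: if_splits)

text \<open>
  The distances between the letters \<open>-1\<close>, \<open>0\<close>, \<open>1\<close>, \<open>3\<close> are \<open>0\<close>, \<open>1\<close> and \<open>2\<close>, which leaves three ranges of scales.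
\<close>

lemma sep_rate_convergent:
  assumes "\<delta> > 0"
  obtains l where "sep_rate marked_shift seq_dist shift \<delta> \<longlonglongrightarrow> l"
proof -
  consider "\<delta> \<le> 1" | "1 < \<delta>" "\<delta> \<le> 2" | "2 < \<delta>" by linarith
  then show ?thesis
  proof cases
    case 1
    obtain K :: nat where K: "1 / 2 ^ K < \<delta>" using fine_scale[OF assms] .
    have "sep_rate marked_shift seq_dist shift \<delta> \<longlonglongrightarrow> ereal (ln (real (card {-1, 0, 1::real})))"
      by (rule sep_rate_tendsto[where \<phi> = erase_marker and K = K, OF _ _ _ erase_marker_near _ K])
        (use 1 in \<open>auto simp: letters_def letter_dist_def\<close>)
    then show ?thesis by (rule that)
  next
    case 2
    \<comment> \<open>\<open>0\<close> may be merged with \<open>1\<close>, and so may the marker, whose position is part of the code.\<close>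
    have "sep_rate marked_shift seq_dist shift \<delta> \<longlonglongrightarrow> ereal (ln (real (card {-1, 1::real})))"
      by (rule sep_rate_tendsto[where \<phi> = "\<lambda>a. if a = -1 then -1 else 1" and K = 0 and c = 1])
        (use 2 in \<open>auto simp: letters_def letter_dist_def\<close>)
    then show ?thesis by (rule that)
  next
    case 3
    have "sep_rate marked_shift seq_dist shift \<delta> \<longlonglongrightarrow> ereal (ln (real (card {0::real})))"
      by (rule sep_rate_tendsto[where \<phi> = "\<lambda>_. 0" and K = 0 and c = 2])
        (use 3 in \<open>auto simp: letter_dist_bounds\<close>)
    then show ?thesis by (rule that)
  qed
qed

section \<open>Entropy\<close>

text \<open>
  At scales up to \<open>1\<close> distinct letters are never close, so the marker-free words of length
  \<open>T\<close> each need their own member of a spanning set.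
\<close>

lemma limsup_span_rate_fine:
  assumes "\<epsilon> > 0" "\<epsilon> \<le> 1"
  shows "limsup (span_rate marked_shift seq_dist shift \<epsilon>) = ereal (ln 3)"
proof -
  let ?A = "{-1, 0, 1::real}"
  obtain K :: nat where K: "1 / 2 ^ K < \<epsilon>" using fine_scale[OF assms(1)] .
  have "3 ^ T \<le> span_number marked_shift \<epsilon> (bowen_dist seq_dist shift T) \<and>
      span_number marked_shift \<epsilon> (bowen_dist seq_dist shift T) \<le> (T + 2 * K + 1) * 3 ^ (T + 2 * K)"
    if T: "T \<ge> 1" for T
  proof -
    have "finite ?A" "erase_marker ` letters \<subseteq> ?A" by (auto simp: letters_def)
    note codes = window_codes_determine[OF this erase_marker_near order_refl K T]
    obtain S where S: "finite S" "spanning_set marked_shift \<epsilon> (bowen_dist seq_dist shift T) S"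
        and "card S \<le> card (window_code {- int K..<int T + int K} erase_marker ` marked_shift)"
      by (rule spanning_set_of_codes[OF codes(1,3)])
    then have cardS: "card S \<le> (T + 2 * K + 1) * card ?A ^ (T + 2 * K)"
      using codes(2) by linarith
    have eq: "a = b" if "letter_dist a b < 1" "a \<in> letters" "b \<in> letters" for a b
      using that by (auto simp: letters_def letter_dist_def)
    have P: "padded_words T ?A \<subseteq> marked_shift" by (rule padded_words_marked_shift) simp
    have follow: "z n = p n"
      if "z \<in> marked_shift" "p \<in> padded_words T ?A" "bowen_dist seq_dist shift T z p < \<epsilon>"
        "n \<in> {0..<int T}" for z p n
    proof (rule eq)
      show "letter_dist (z n) (p n) < 1"
        using letter_le_bowen_dist[of n T z p] that assms(2) by auto
    qed (use that P marked_shiftD(1) in blast)+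
    have "card (padded_words T ?A) \<le> span_number marked_shift \<epsilon> (bowen_dist seq_dist shift T)"
    proof (rule span_number_ge_card[OF S(1,2) P])
      fix z p q assume z: "z \<in> marked_shift"
        and p: "p \<in> padded_words T ?A" and q: "q \<in> padded_words T ?A"
        and zp: "bowen_dist seq_dist shift T z p < \<epsilon>"
        and zq: "bowen_dist seq_dist shift T z q < \<epsilon>"
      show "p = q"
        by (rule padded_words_eqI[OF p q]) (use follow[OF z p zp] follow[OF z q zq] in simp)
    qed
    moreover have "card ?A = 3" by simp
    ultimately show ?thesis
      using span_number_le_card[OF S(1,2)] cardS by (metis card_padded_words order_trans)
  qed
  then have "span_rate marked_shift seq_dist shift \<epsilon> \<longlonglongrightarrow> ereal (ln (real 3))"
    unfolding span_rate_def[abs_def] by (intro exponential_growth_rate) auto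
  then show ?thesis using lim_imp_Limsup by force
qed

lemma topological_entropy_marked_shift:
  "topological_entropy marked_shift seq_dist shift = ereal (ln 3)"
proof -
  have "\<forall>\<^sub>F \<epsilon> in at_right 0. limsup (span_rate marked_shift seq_dist shift \<epsilon>) = ereal (ln 3)"
    unfolding eventually_at_right_field
    by (intro exI[of _ 1]) (simp add: limsup_span_rate_fine)
  then have "((\<lambda>\<epsilon>. limsup (span_rate marked_shift seq_dist shift \<epsilon>)) \<longlongrightarrow> ereal (ln 3)) (at_right 0)"
    by (rule tendsto_eventually)
  then show ?thesis unfolding topological_entropy_def by (intro tendsto_Lim) simp
qed

section \<open>Oscillation of the spanning numbers\<close>

text \<open>
  These are the sparsest points with marker at \<open>m\<close>: they vanish wherever they may. The signs are
  prescribed by \<open>w\<close> only on the runs below \<open>T\<close> and are \<open>1\<close> beyond, so that there are finitely many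
  centres for each \<open>T\<close> and \<open>m\<close>.
\<close>

definition centre :: "nat \<Rightarrow> int \<Rightarrow> (nat \<Rightarrow> real) \<Rightarrow> int \<Rightarrow> real" where
  "centre T m w n = (if n = m then 3 else if m < n \<and> nat (n - m) \<in> runs
     then if nat (n - m) < T then w (nat (n - m)) else 1 else 0)"

lemma centre_marked_shift:
  assumes "w \<in> (runs \<inter> {..<T}) \<rightarrow>\<^sub>E {-1, 1}"
  shows "centre T m w \<in> marked_shift"
proof -
  have w: "w k \<in> {-1, 1}" if "k \<in> runs" "k < T" for k
    using assms that by (auto simp: PiE_iff)
  have run: "centre T m w (m + int k) \<in> {-1, 1}" if "k \<in> runs" for k
    using that w runs_pos[OF that] by (auto simp: centre_def)
  have other: "centre T m w n \<in> {-1, 0, 1}" if "n \<noteq> m" for n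
    using that w by (auto simp: centre_def)
  have marker: "n = m" if "centre T m w n = 3" for n
    using other[of n] that by fastforce
  show ?thesis
  proof (rule marked_shiftI)
    show "centre T m w n \<in> letters" for n
      using other[of n] by (cases "n = m") (auto simp: letters_def centre_def)
  qed (use marker run in blast)+
qed

text \<open>
  For the upper bound, a point without a marker in the window is dominated by the zero sequence and
  one with marker at \<open>m\<close> by the centre that copies its signs on the runs after \<open>m\<close>. For the lower
  bound, consider the centres with marker at \<open>0\<close>: anything close to such a centre
  has its marker at \<open>0\<close> as well, hence signs on all runs, and these must be the signs of the centre.
\<close>

lemma span_number_coarse:
  assumes T: "T \<ge> 1"
  shows "2 ^ card (runs \<inter> {..<T}) \<le> span_number marked_shift 2 (bowen_dist seq_dist shift T)"
    "span_number marked_shift 2 (bowen_dist seq_dist shift T) \<le> 1 + T * 2 ^ card (runs \<inter> {..<T})"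
proof -
  let ?F = "runs \<inter> {..<T}"
  let ?B = "?F \<rightarrow>\<^sub>E {-1, 1::real}"
  let ?S = "insert (\<lambda>_. 0) ((\<lambda>(m, w). centre T m w) ` ({0..<int T} \<times> ?B))"
  have finB: "finite ?B" by (intro finite_PiE) auto
  have cardB: "card ?B = 2 ^ card ?F" by (simp add: card_PiE numeral_2_eq_2)
  have finS: "finite ?S"
    by (intro finite.insertI finite_imageI finite_cartesian_product finB) simp
  have spanS: "spanning_set marked_shift 2 (bowen_dist seq_dist shift T) ?S"
    unfolding spanning_set_def
  proof (intro conjI ballI)
    have "(\<lambda>_. 0) \<in> marked_shift" by (simp add: marked_shift_def letters_def)
    then show "?S \<subseteq> marked_shift" using centre_marked_shift by auto
    fix z assume z: "z \<in> marked_shift"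
    have zero: "letter_dist 0 (z n) \<le> 1" if "z n \<noteq> 3" for n
      using marked_shiftD(1)[OF z, of n] that by (auto simp: letters_def letter_dist_def)
    show "\<exists>s\<in>?S. bowen_dist seq_dist shift T s z < 2"
    proof (cases "\<exists>m\<in>{0..<int T}. z m = 3")
      case False
      have "bowen_dist seq_dist shift T (\<lambda>_. 0) z \<le> 1"
        by (rule bowen_dist_le_of_window[of T 0, OF T]) (use False zero in auto)
      then show ?thesis by (intro bexI[of _ "\<lambda>_. 0"]) auto
    next
      case True
      then obtain m where m: "m \<in> {0..<int T}" "z m = 3" by blast
      define w where "w = restrict (\<lambda>k. z (m + int k)) ?F"
      have w: "w \<in> ?B" using marked_shiftD(3)[OF z _ m(2)] by (auto simp: w_def)
      have "bowen_dist seq_dist shift T (centre T m w) z \<le> 1"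
      proof (rule bowen_dist_le_of_window[of T 0, OF T])
        fix n assume "n \<in> {- int 0..<int T + int 0}"
        then have n: "0 \<le> n" "n < int T" by auto
        consider "n = m" | "m < n" "nat (n - m) \<in> runs" 
          | "n \<noteq> m" "\<not> (m < n \<and> nat (n - m) \<in> runs)"
          by blast
        then show "letter_dist (centre T m w n) (z n) \<le> 1"
        proof cases
          case 1
          then show ?thesis using m by (simp add: centre_def letter_dist_def)
        next
          case 2
          then have "centre T m w n = z n" using n m(1) by (simp add: centre_def w_def)
          then show ?thesis by (simp add: letter_dist_def)
        next
          case 3
          then have "centre T m w n = 0" by (auto simp: centre_def)
          moreover have "z n \<noteq> 3" using 3(1) marked_shiftD(2)[OF z m(2), of n] by blast
          ultimately show ?thesis using zero[of n] by simp
        qed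
      qed simp
      then show ?thesis using m w by (intro bexI[of _ "centre T m w"]) auto
    qed
  qed
  have "card ?S \<le> Suc (card ((\<lambda>(m, w). centre T m w) ` ({0..<int T} \<times> ?B)))"
    using finB by (simp add: card_insert_if)
  also have "card ((\<lambda>(m, w). centre T m w) ` ({0..<int T} \<times> ?B)) \<le> card ({0..<int T} \<times> ?B)"
    by (rule card_image_le) (use finB in simp)
  also have "card ({0..<int T} \<times> ?B) = T * 2 ^ card ?F"
    by (simp add: card_cartesian_product cardB)
  finally show "span_number marked_shift 2 (bowen_dist seq_dist shift T) \<le> 1 + T * 2 ^ card ?F"
    using span_number_le_card[OF finS spanS] by simp
  let ?P = "centre T 0 ` ?B"
  have read: "centre T 0 w (int k) = w k" if "k \<in> ?F" for w k
    using that runs_pos[of k] by (simp add: centre_def)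
  have inj: "inj_on (centre T 0) ?B"
  proof (rule inj_onI)
    fix v w assume v: "v \<in> ?B" and w: "w \<in> ?B" and eq: "centre T 0 v = centre T 0 w"
    show "v = w"
    proof (rule PiE_ext[OF v w])
      fix k assume "k \<in> ?F"
      then show "v k = w k" using fun_cong[OF eq, of "int k"] by (simp add: read)
    qed
  qed
  have follow: "z (int k) = w k"
    if z: "z \<in> marked_shift" and w: "w \<in> ?B" and k: "k \<in> ?F"
      and d: "bowen_dist seq_dist shift T z (centre T 0 w) < 2" for z w k
  proof -
    have close: "letter_dist (z n) (centre T 0 w n) < 2" if "0 \<le> n" "n < int T" for n
      using letter_le_bowen_dist[OF that, of z "centre T 0 w"] d by linarith
    have "z 0 = 3"
      using close[of 0] T marked_shiftD(1)[OF z, of 0]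
      by (auto simp: centre_def letters_def letter_dist_def)
    then have "z (int k) \<in> {-1, 1}" using marked_shiftD(3)[OF z, of k 0] k by simp
    moreover have "w k \<in> {-1, 1}" using w k by blast
    moreover have "letter_dist (z (int k)) (w k) < 2"
      using close[of "int k"] k read[OF k] by simp
    ultimately show ?thesis by (auto simp: letter_dist_def)
  qed
  have "card ?P \<le> span_number marked_shift 2 (bowen_dist seq_dist shift T)"
  proof (rule span_number_ge_card[OF finS spanS])
    show "?P \<subseteq> marked_shift" using centre_marked_shift by blast
    fix z p q assume z: "z \<in> marked_shift" and p: "p \<in> ?P" and q: "q \<in> ?P"
      and zp: "bowen_dist seq_dist shift T z p < 2" and zq: "bowen_dist seq_dist shift T z q < 2"
    obtain v w where v: "v \<in> ?B" "p = centre T 0 v" and w: "w \<in> ?B" "q = centre T 0 w"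
      using p q by blast
    have "v = w"
      by (rule PiE_ext[OF v(1) w(1)])
        (use follow[OF z v(1)] follow[OF z w(1)] zp zq v(2) w(2) in simp)
    then show "p = q" using v w by simp
  qed
  then show "2 ^ card ?F \<le> span_number marked_shift 2 (bowen_dist seq_dist shift T)"
    by (simp add: card_image[OF inj] cardB)
qed

lemma runs_dense: "3 * 16 ^ k \<le> card (runs \<inter> {..<4 * 16 ^ k})"
proof -
  have "{16 ^ k..<4 * 16 ^ k} \<subseteq> runs \<inter> {..<4 * 16 ^ k}" by (auto simp: runs_def)
  from card_mono[OF _ this] show ?thesis by simp
qed

lemma runs_sparse: "card (runs \<inter> {..<16 ^ Suc k}) \<le> 4 * 16 ^ k"
proof -
  have "n < 4 * 16 ^ k" if "16 ^ j \<le> n" "n < 4 * 16 ^ j" "n < 16 ^ Suc k" for n j :: nat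
  proof -
    have "(16::nat) ^ j < 16 ^ Suc k" using that by linarith
    then have "j < Suc k" by (rule power_less_imp_less_exp[rotated]) simp
    then have "(16::nat) ^ j \<le> 16 ^ k" by (intro power_increasing) auto
    then show ?thesis using that by linarith
  qed
  then have "runs \<inter> {..<16 ^ Suc k} \<subseteq> {..<4 * 16 ^ k}" by (auto simp: runs_def)
  from card_mono[OF _ this] show ?thesis by simp
qed

lemma limsup_span_rate_coarse:
  "ereal (3 / 4 * ln 2) \<le> limsup (span_rate marked_shift seq_dist shift 2)"
proof -
  let ?f = "span_rate marked_shift seq_dist shift 2"
  define r where "r k = 4 * (16::nat) ^ k" for k
  have r: "strict_mono r" by (auto simp: r_def intro!: strict_monoI power_strict_increasing)
  have "ereal (3 / 4 * ln 2) \<le> ?f (r k)" for k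
  proof -
    let ?N = "span_number marked_shift 2 (bowen_dist seq_dist shift (r k))"
    have r1: "r k \<ge> 1" by (simp add: r_def)
    have "(2::nat) ^ (3 * 16 ^ k) \<le> 2 ^ card (runs \<inter> {..<r k})"
      unfolding r_def by (intro power_increasing runs_dense) simp
    also have "\<dots> \<le> ?N" by (rule span_number_coarse(1)[OF r1])
    finally have "real (2 ^ (3 * 16 ^ k)) \<le> real ?N" using of_nat_le_iff by blast
    then have "ln (2 ^ (3 * 16 ^ k)) \<le> ln (real ?N)"
      by (subst ln_le_cancel_iff) (auto intro: less_le_trans[rotated])
    then have "3 * 16 ^ k * ln 2 \<le> ln (real ?N)" by (simp add: ln_realpow)
    then show ?thesis by (simp add: span_rate_def r_def field_simps)
  qed
  then have "ereal (3 / 4 * ln 2) \<le> limsup (?f \<circ> r)"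
    by (intro le_Limsup) auto
  also have "\<dots> \<le> limsup ?f" by (rule limsup_subseq_mono[OF r])
  finally show ?thesis .
qed

lemma liminf_span_rate_coarse:
  "liminf (span_rate marked_shift seq_dist shift 2) \<le> ereal (1 / 4 * ln 2)"
proof -
  let ?f = "span_rate marked_shift seq_dist shift 2"
  define r where "r k = (16::nat) ^ Suc k" for k
  define u where "u T = ln (2 * real T) / real T + 1 / 4 * ln 2" for T :: nat
  have r: "strict_mono r"
    unfolding r_def by (intro strict_monoI power_strict_increasing) auto
  have "u \<longlonglongrightarrow> 0 + 1 / 4 * ln 2"
    unfolding u_def by (intro tendsto_add tendsto_const) real_asymp
  then have "(\<lambda>k. u (r k)) \<longlonglongrightarrow> 1 / 4 * ln 2"
    using LIMSEQ_subseq_LIMSEQ[OF _ r] by (force simp: o_def)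
  then have lim: "liminf (\<lambda>k. ereal (u (r k))) = ereal (1 / 4 * ln 2)"
    by (intro lim_imp_Liminf) auto
  have "?f (r k) \<le> ereal (u (r k))" for k
  proof -
    let ?N = "span_number marked_shift 2 (bowen_dist seq_dist shift (r k))"
    let ?g = "card (runs \<inter> {..<r k})"
    have r1: "r k \<ge> 1" by (simp add: r_def)
    have "?N \<le> 1 + r k * 2 ^ ?g" by (rule span_number_coarse(2)[OF r1])
    also have "\<dots> \<le> r k * 2 ^ ?g + r k * 2 ^ ?g" using r1 by simp
    also have "\<dots> = 2 * r k * 2 ^ ?g" by simp
    also have "\<dots> \<le> 2 * r k * 2 ^ (4 * 16 ^ k)"
      unfolding r_def by (intro mult_left_mono power_increasing runs_sparse) auto
    finally have "real ?N \<le> real (2 * r k * 2 ^ (4 * 16 ^ k))" using of_nat_le_iff by blast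
    moreover have "0 < ?N"
      by (rule less_le_trans[OF _ span_number_coarse(1)[OF r1]]) simp
    ultimately have "ln (real ?N) \<le> ln (real (2 * r k * 2 ^ (4 * 16 ^ k)))" by simp
    also have "\<dots> = ln (2 * real (r k)) + 4 * 16 ^ k * ln 2"
      using r1 by (simp add: ln_mult ln_realpow)
    finally show ?thesis using r1 by (simp add: span_rate_def u_def field_simps r_def)
  qed
  then have "liminf (?f \<circ> r) \<le> ereal (1 / 4 * ln 2)"
    unfolding lim[symmetric] by (intro Liminf_mono always_eventually) simp
  with liminf_subseq_mono[OF r, of ?f] show ?thesis by (rule order_trans)
qed

theorem theorem4:
  shows "\<exists>(Z :: (int \<Rightarrow> real) set) (\<rho> :: (int \<Rightarrow> real) \<Rightarrow> (int \<Rightarrow> real) \<Rightarrow> real)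
            (H :: (int \<Rightarrow> real) \<Rightarrow> (int \<Rightarrow> real)).
      Metric_space Z \<rho> \<and>
      compact_space (Metric_space.mtopology Z \<rho>) \<and>
      homeomorphic_map (Metric_space.mtopology Z \<rho>) (Metric_space.mtopology Z \<rho>) H \<and>
      (\<exists>\<epsilon>>0. liminf (span_rate Z \<rho> H \<epsilon>) < limsup (span_rate Z \<rho> H \<epsilon>)) \<and>
      (\<forall>\<delta>>0. liminf (sep_rate Z \<rho> H \<delta>) = limsup (sep_rate Z \<rho> H \<delta>)) \<and>
      topological_entropy Z \<rho> H < \<infinity>"
proof (intro exI conjI allI impI)
  show "Metric_space marked_shift seq_dist" by (rule seq_dist_metric)
  show "compact_space (Metric_space.mtopology marked_shift seq_dist)" by (rule compact_marked_shift)
  show "homeomorphic_map (Metric_space.mtopology marked_shift seq_dist)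
      (Metric_space.mtopology marked_shift seq_dist) shift" by (rule homeomorphic_shift)
  show "(2::real) > 0" by simp
  have "ereal (1 / 4 * ln 2) < ereal (3 / 4 * ln 2)" by simp
  then show "liminf (span_rate marked_shift seq_dist shift 2)
      < limsup (span_rate marked_shift seq_dist shift 2)"
    using liminf_span_rate_coarse limsup_span_rate_coarse by (meson le_less_trans less_le_trans)
  show "liminf (sep_rate marked_shift seq_dist shift \<delta>) = limsup (sep_rate marked_shift seq_dist shift \<delta>)"
    if \<delta>: "\<delta> > 0" for \<delta>
  proof -
    obtain l where "sep_rate marked_shift seq_dist shift \<delta> \<longlonglongrightarrow> l"
      using sep_rate_convergent[OF \<delta>] .
    then show ?thesis using lim_imp_Liminf lim_imp_Limsup by (metis sequentially_bot)
  qed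
  show "topological_entropy marked_shift seq_dist shift < \<infinity>"
    by (simp add: topological_entropy_marked_shift)
qed

end
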